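(* Consider the linear system $\frac{dx}{dt}=A(t)x$, $t\in[t_0,T]$, let $z_0\in\mathbb{R}^n$, let $Q$ be a positive definite symmetric $n\times n$ matrix, and take the set of initial conditions in the form $G_0=\hat K_c(z_0)$, where $c>0$ and $$\hat K_c(z_0)=\{x\in\mathbb{R}^n:(x-z_0)^TQ(x-z_0)\le c^2\},$$ with phase restrictions $\Gamma_t$, $t\in[t_0,T]$. Then the maximal $c^*$ among those $c>0$ for which the trivial solution of the linear system is $\{\hat K_c(z_0),\Gamma_t,t_0,T\}$-stable is $$c^*=\min_{t\in[t_0,T]}\ \min_{s=1,2,\dots,N}\ \frac{1-\left|l_s^T(t)X(t,t_0)z_0\right|}{\sqrt{l_s^T(t)H(t)l_s(t)}},$$ where $H(t)=X(t,t_0)Q^{-1}X^T(t,t_0)$ satisfies the matrix differential equation $\frac{dH(t)}{dt}=A(t)H(t)+H(t)A^T(t)$, $t\in[t_0,T]$, with initial condition $H(t_0)=Q^{-1}$.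
   Context: $A(t)$ is an $n\times n$ matrix with components continuous on $[t_0,T]$, and $X(t,t_0)$ is the fundamental matrix of solutions of $\frac{dx}{dt}=A(t)x$ normalized with respect to $t_0$, i.e. $X(t_0,t_0)$ is the identity matrix. Denote by $x(t,x_0,t_0)=X(t,t_0)x_0$ the solution with $x(t_0)=x_0$. For $s=1,2,\dots,N$, $l_s(t)$ is a continuous $n$-dimensional vector function on $[t_0,T]$, and $$\Gamma_t=\{x\in\mathbb{R}^n: |l_s^T(t)x|\le 1,\ s=1,2,\dots,N\},\quad t\in[t_0,T].$$ Definition. The trivial solution $x(t)\equiv 0$ is said to be $\{G_0,\Gamma_t,t_0,T\}$-stable if $x(t,x_0,t_0)\in\Gamma_t$ for all $t\in[t_0,T]$ as soon as $x_0\in G_0$. Standing assumptions on the sets in this definition: the phase restriction sets $\Gamma_t\subset\mathbb{R}^n$ are compact with $0\in\Gamma_t$ for $t\in[t_0,T]$, and the set of initial conditions satisfies $G_0\subseteq\Gamma_{t_0}$ and $0\in G_0$.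
   Formalization: Maximality of c* is claimed provided at least one c>0 gives stability (otherwise no maximal c exists, and the minimum is not positive); where l_s(t)=0 the undefined quotient is read as +∞, i.e. as no constraint. *)

theory Defs
  imports "HOL-Analysis.Analysis"
begin

definition fundamental_matrix ::
  "(real \<Rightarrow> real^'n^'n) \<Rightarrow> real \<Rightarrow> real \<Rightarrow> (real \<Rightarrow> real^'n^'n) \<Rightarrow> bool" where
  "fundamental_matrix A t0 T X \<longleftrightarrow>
     X t0 = mat 1 \<and>
     (\<forall>t\<in>{t0..T}. (X has_vector_derivative (A t ** X t)) (at t within {t0..T}))"

definition solution :: "(real \<Rightarrow> real^'n^'n) \<Rightarrow> real \<Rightarrow> real^'n \<Rightarrow> real^'n" where
  "solution X t x0 = X t *v x0"

definition sym_pos_def :: "real^'n^'n \<Rightarrow> bool" where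
  "sym_pos_def Q \<longleftrightarrow> transpose Q = Q \<and> (\<forall>x. x \<noteq> 0 \<longrightarrow> 0 < x \<bullet> (Q *v x))"

definition phase_set :: "nat \<Rightarrow> (nat \<Rightarrow> real \<Rightarrow> real^'n) \<Rightarrow> real \<Rightarrow> (real^'n) set" where
  "phase_set N l t = {x. \<forall>s\<in>{1..N}. \<bar>l s t \<bullet> x\<bar> \<le> 1}"

definition ellipsoid :: "real^'n^'n \<Rightarrow> real^'n \<Rightarrow> real \<Rightarrow> (real^'n) set" where
  "ellipsoid Q z0 c = {x. (x - z0) \<bullet> (Q *v (x - z0)) \<le> c\<^sup>2}"

definition trivial_solution_stable ::
  "(real \<Rightarrow> real^'n^'n) \<Rightarrow> (real^'n) set \<Rightarrow> (real \<Rightarrow> (real^'n) set) \<Rightarrow> real \<Rightarrow> real \<Rightarrow> bool" where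
  "trivial_solution_stable X G0 \<Gamma> t0 T \<longleftrightarrow> (\<forall>x0\<in>G0. \<forall>t\<in>{t0..T}. solution X t x0 \<in> \<Gamma> t)"

text \<open>
  The requirement \<open>0 \<in> \<Gamma> t\<close> needs no separate hypothesis, as it always holds for \<open>phase_set\<close>.
\<close>

definition admissible_initial_set ::
  "(real^'n) set \<Rightarrow> (real \<Rightarrow> (real^'n) set) \<Rightarrow> real \<Rightarrow> bool" where
  "admissible_initial_set G0 \<Gamma> t0 \<longleftrightarrow> 0 \<in> G0 \<and> G0 \<subseteq> \<Gamma> t0"

definition H_matrix :: "(real \<Rightarrow> real^'n^'n) \<Rightarrow> real^'n^'n \<Rightarrow> real \<Rightarrow> real^'n^'n" where
  "H_matrix X Q t = X t ** matrix_inv Q ** transpose (X t)"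

text \<open>
  The quotient is taken in the extended reals because some \<open>l s t\<close> may vanish: the constraint
  with index \<open>s\<close> is then void at time \<open>t\<close>, and the quotient is \<open>1 / 0 = \<infinity>\<close>, which does not
  contribute to the minimum. (In the type \<open>real\<close> it would be \<open>0\<close>.)
\<close>

definition bound_ratio ::
  "(real \<Rightarrow> real^'n^'n) \<Rightarrow> real^'n^'n \<Rightarrow> (nat \<Rightarrow> real \<Rightarrow> real^'n) \<Rightarrow> real^'n \<Rightarrow> real \<Rightarrow> nat \<Rightarrow> ereal" where
  "bound_ratio X Q l z0 t s =
     ereal (1 - \<bar>l s t \<bullet> (X t *v z0)\<bar>) / ereal (sqrt (l s t \<bullet> (H_matrix X Q t *v l s t)))"

text \<open>These two also assert that the extremum is attained.\<close>

definition is_minimum :: "'a::linorder \<Rightarrow> 'a set \<Rightarrow> bool" where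
  "is_minimum m S \<longleftrightarrow> m \<in> S \<and> (\<forall>y\<in>S. m \<le> y)"

definition is_maximum :: "'a::linorder \<Rightarrow> 'a set \<Rightarrow> bool" where
  "is_maximum m S \<longleftrightarrow> m \<in> S \<and> (\<forall>y\<in>S. y \<le> m)"

end

theory Submission imports Defs begin

text \<open>
  By Cauchy--Schwarz for the inner product given by \<open>Q\<close>, the supremum of \<open>\<bar>a \<bullet> x\<bar>\<close> over the
  ellipsoid of radius \<open>c\<close> about \<open>z0\<close> is \<open>\<bar>a \<bullet> z0\<bar> + c * sqrt (a \<bullet> Q\<^sup>-\<^sup>1 a)\<close>. Taking
  \<open>a = X(t)\<^sup>T l\<^sub>s(t)\<close> turns stability into the inequalities \<open>c \<le> bound_ratio\<close>, for all \<open>t\<close> and \<open>s\<close>. The ratio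
  is a continuous extended-real function of \<open>t\<close>, including where \<open>l\<^sub>s(t) = 0\<close>, because \<open>X(t)\<close> is
  invertible and so the denominator vanishes only where the numerator is \<open>1\<close>. Hence the minimum is attained.
  It is finite because a compact phase set excludes that all \<open>l\<^sub>s(t)\<close> vanish.
\<close>

section \<open>Matrix products, transposition and inverses\<close>

lemma bounded_bilinear_matrix_vector_mult:
  "bounded_bilinear ((*v) :: real^'n^'m \<Rightarrow> real^'n \<Rightarrow> real^'m)"
proof -
  have "linear (\<lambda>A :: real^'n^'m. A *v x)" for x :: "real^'n"
    by (rule linearI) (simp_all add: matrix_vector_mult_add_rdistrib scaleR_matrix_vector_assoc)
  then show ?thesis
    by (simp add: bilinear_conv_bounded_bilinear[symmetric] bilinear_def)
qed

lemma bounded_bilinear_matrix_matrix_mult: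
  "bounded_bilinear ((**) :: real^'n^'m \<Rightarrow> real^'k^'n \<Rightarrow> real^'k^'m)"
proof -
  have "linear (\<lambda>A :: real^'n^'m. A ** B)" for B :: "real^'k^'n"
    by (rule linearI)
      (simp_all add: vec_eq_iff matrix_matrix_mult_def sum.distrib algebra_simps sum_distrib_left)
  moreover have "linear (\<lambda>B :: real^'k^'n. A ** B)" for A :: "real^'n^'m"
    by (rule linearI)
      (simp_all add: vec_eq_iff matrix_matrix_mult_def sum.distrib algebra_simps sum_distrib_left)
  ultimately show ?thesis
    by (simp add: bilinear_conv_bounded_bilinear[symmetric] bilinear_def)
qed

lemma bounded_linear_transpose: "bounded_linear (transpose :: real^'n^'m \<Rightarrow> real^'m^'n)"
  unfolding linear_conv_bounded_linear[symmetric]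
  by (rule linearI) (simp_all add: vec_eq_iff transpose_def)

lemma matrix_mul_inv_right:
  fixes A :: "real^'n^'n"
  assumes "invertible A"
  shows "A ** matrix_inv A = mat 1"
proof -
  have "\<exists>B. A ** B = mat 1 \<and> B ** A = mat 1"
    using assms by (simp add: invertible_def)
  from someI_ex[OF this] show ?thesis
    by (simp add: matrix_inv_def)
qed

section \<open>The inner product given by \<open>Q\<close> and its ellipsoids\<close>

lemma sym_pos_def_inner_commute:
  assumes "sym_pos_def Q"
  shows "x \<bullet> (Q *v y) = y \<bullet> (Q *v x)"
proof -
  have "x \<bullet> (Q *v y) = (transpose Q *v x) \<bullet> y"
    by (simp add: dot_lmul_matrix)
  then show ?thesis
    using assms by (simp only: sym_pos_def_def inner_commute)
qed

lemma sym_pos_def_inner_nonneg: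
  assumes "sym_pos_def Q"
  shows "0 \<le> x \<bullet> (Q *v x)"
  using assms by (cases "x = 0") (auto simp: sym_pos_def_def less_imp_le)

lemma sym_pos_def_invertible:
  assumes "sym_pos_def Q"
  shows "invertible Q"
  unfolding invertible_left_inverse matrix_left_invertible_ker
  using assms by (metis inner_zero_right less_irrefl sym_pos_def_def)

lemma sym_pos_def_cauchy_schwarz:
  assumes Q: "sym_pos_def Q"
  shows "(x \<bullet> (Q *v y))\<^sup>2 \<le> (x \<bullet> (Q *v x)) * (y \<bullet> (Q *v y))"
proof (cases "y = 0")
  case False
  define p where "p = y \<bullet> (Q *v y)"
  define r where "r = x \<bullet> (Q *v y)"
  have p: "p > 0"
    using Q False by (simp add: sym_pos_def_def p_def)
  \<comment> \<open>Up to the factor \<open>p\<close>, this vector is the component of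
    \<open>x\<close> that is orthogonal to \<open>y\<close> with respect to
    \<open>Q\<close>.\<close>
  have "0 \<le> (p *\<^sub>R x - r *\<^sub>R y) \<bullet> (Q *v (p *\<^sub>R x - r *\<^sub>R y))"
    by (rule sym_pos_def_inner_nonneg[OF Q])
  also have "\<dots> = p * (p * (x \<bullet> (Q *v x)) - r\<^sup>2)"
    using sym_pos_def_inner_commute[OF Q, of y x]
    by (simp add: matrix_vector_mult_diff_distrib matrix_vector_mult_scaleR inner_diff_left
        inner_diff_right p_def[symmetric] r_def[symmetric] power2_eq_square algebra_simps)
  finally show ?thesis
    using p by (simp add: zero_le_mult_iff p_def[symmetric] r_def[symmetric] mult.commute)
qed simp

text \<open>The functional \<open>a\<close> is represented in the \<open>Q\<close>-inner product by
  \<open>matrix_inv Q *v a\<close>, so Cauchy-Schwarz for \<open>Q\<close> applies to it; the second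
  equation gives the squared \<open>Q\<close>-length of this representative.\<close>

lemma sym_pos_def_inner_inv:
  assumes Q: "sym_pos_def Q"
  shows "a \<bullet> w = w \<bullet> (Q *v (matrix_inv Q *v a))"
    and "a \<bullet> (matrix_inv Q *v a) = (matrix_inv Q *v a) \<bullet> (Q *v (matrix_inv Q *v a))"
proof -
  have "Q *v (matrix_inv Q *v a) = a"
    by (simp add: matrix_vector_mul_assoc matrix_mul_inv_right sym_pos_def_invertible[OF Q])
  then show "a \<bullet> w = w \<bullet> (Q *v (matrix_inv Q *v a))"
    and "a \<bullet> (matrix_inv Q *v a) = (matrix_inv Q *v a) \<bullet> (Q *v (matrix_inv Q *v a))"
    by (simp_all add: inner_commute)
qed

lemma sym_pos_def_inv_nonneg:
  assumes "sym_pos_def Q"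
  shows "0 \<le> a \<bullet> (matrix_inv Q *v a)"
  unfolding sym_pos_def_inner_inv(2)[OF assms] by (rule sym_pos_def_inner_nonneg[OF assms])

lemma sym_pos_def_inv_pos:
  assumes Q: "sym_pos_def Q" and "a \<noteq> 0"
  shows "0 < a \<bullet> (matrix_inv Q *v a)"
proof -
  have "matrix_inv Q *v a \<noteq> 0"
    using sym_pos_def_inner_inv(1)[OF Q, of a a] \<open>a \<noteq> 0\<close> by auto
  then show ?thesis
    using Q unfolding sym_pos_def_inner_inv(2)[OF Q] by (simp add: sym_pos_def_def)
qed

lemma ellipsoid_abs_inner_le_iff:
  assumes Q: "sym_pos_def Q" and c: "0 \<le> c"
  shows "(\<forall>x\<in>ellipsoid Q z0 c. \<bar>a \<bullet> x\<bar> \<le> d)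
    \<longleftrightarrow> \<bar>a \<bullet> z0\<bar> + c * sqrt (a \<bullet> (matrix_inv Q *v a)) \<le> d"
proof
  define b where "b = matrix_inv Q *v a"
  define h where "h = a \<bullet> b"
  have ab: "a \<bullet> w = w \<bullet> (Q *v b)" for w
    unfolding b_def by (rule sym_pos_def_inner_inv(1)[OF Q])
  have h: "h = b \<bullet> (Q *v b)" "0 \<le> h"
    unfolding h_def b_def using sym_pos_def_inner_inv(2)[OF Q] sym_pos_def_inv_nonneg[OF Q] by auto
  show "\<bar>a \<bullet> z0\<bar> + c * sqrt (a \<bullet> (matrix_inv Q *v a)) \<le> d"
    if L: "\<forall>x\<in>ellipsoid Q z0 c. \<bar>a \<bullet> x\<bar> \<le> d"
  proof (cases "h = 0")
    \<comment> \<open>The square root vanishes, so testing the centre is enough.\<close>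
    case True
    have "z0 \<in> ellipsoid Q z0 c"
      by (simp add: ellipsoid_def)
    with L True show ?thesis
      by (simp add: h_def b_def)
  next
    case False
    \<comment> \<open>The extremal point is \<open>z0 + w\<close>: \<open>w\<close> is
      \<open>b\<close> rescaled to \<open>Q\<close>-length \<open>c\<close>, and the sign
      \<open>e\<close> lets \<open>a \<bullet> w\<close> add to \<open>a \<bullet> z0\<close>
      without cancellation.\<close>
    define e :: real where "e = (if a \<bullet> z0 \<ge> 0 then 1 else - 1)"
    define w where "w = (e * c / sqrt h) *\<^sub>R b"
    have "w \<bullet> (Q *v w) = (e * c / sqrt h)\<^sup>2 * h"
      by (simp add: w_def matrix_vector_mult_scaleR h(1) power2_eq_square)
    also have "\<dots> = c\<^sup>2"
      using False h(2) by (simp add: e_def power_divide power_mult_distrib)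
    finally have "z0 + w \<in> ellipsoid Q z0 c"
      by (simp add: ellipsoid_def)
    with L have "\<bar>a \<bullet> (z0 + w)\<bar> \<le> d"
      by blast
    moreover have "a \<bullet> w = e * c * (h / sqrt h)"
      by (simp add: w_def h_def)
    then have "a \<bullet> w = e * (c * sqrt h)"
      using h(2) by (simp add: real_div_sqrt)
    then have "\<bar>a \<bullet> (z0 + w)\<bar> = \<bar>a \<bullet> z0\<bar> + c * sqrt h"
      using mult_nonneg_nonneg[OF c, of "sqrt h"] h(2) by (simp add: inner_add_right e_def)
    ultimately show ?thesis
      by (simp add: h_def b_def)
  qed
  show "\<forall>x\<in>ellipsoid Q z0 c. \<bar>a \<bullet> x\<bar> \<le> d"
    if R: "\<bar>a \<bullet> z0\<bar> + c * sqrt (a \<bullet> (matrix_inv Q *v a)) \<le> d"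
  proof
    fix x assume x: "x \<in> ellipsoid Q z0 c"
    have "(a \<bullet> (x - z0))\<^sup>2 \<le> ((x - z0) \<bullet> (Q *v (x - z0))) * h"
      unfolding ab h(1) by (rule sym_pos_def_cauchy_schwarz[OF Q])
    also have "\<dots> \<le> c\<^sup>2 * h"
      using x h(2) by (intro mult_right_mono) (simp_all add: ellipsoid_def)
    finally have "sqrt ((a \<bullet> (x - z0))\<^sup>2) \<le> sqrt (c\<^sup>2 * h)"
      by (rule real_sqrt_le_mono)
    then have "\<bar>a \<bullet> (x - z0)\<bar> \<le> c * sqrt h"
      using c by (simp add: real_sqrt_mult)
    with R show "\<bar>a \<bullet> x\<bar> \<le> d"
      unfolding h_def b_def by (simp add: inner_diff_right)
  qed
qed

section \<open>The fundamental matrix and \<open>H_matrix\<close>\<close>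

lemma fundamental_matrix_continuous_on:
  assumes "fundamental_matrix A t0 T X"
  shows "continuous_on {t0..T} X"
  using assms by (intro continuous_on_vector_derivative[of _ _ "\<lambda>t. A t ** X t"])
    (simp add: fundamental_matrix_def)

text \<open>
  A solution \<open>y\<close> satisfies \<open>(\<bar>y\<bar>\<^sup>2)' = 2 (y \<bullet> A y) \<ge> - 2 M \<bar>y\<bar>\<^sup>2\<close> where \<open>M\<close> bounds \<open>A\<close>, so
  \<open>exp (2 M t) \<bar>y\<bar>\<^sup>2\<close> is nondecreasing and \<open>y\<close> cannot reach \<open>0\<close>.
\<close>

lemma fundamental_matrix_invertible:
  fixes A X :: "real \<Rightarrow> real^'n^'n"
  assumes A: "continuous_on {t0..T} A" and X: "fundamental_matrix A t0 T X"
    and t: "t \<in> {t0..T}"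
  shows "invertible (X t)"
proof -
  interpret mv: bounded_bilinear "(*v) :: real^'n^'n \<Rightarrow> real^'n \<Rightarrow> real^'n"
    by (rule bounded_bilinear_matrix_vector_mult)
  obtain K where K: "0 \<le> K" "\<And>B v. norm ((B :: real^'n^'n) *v v) \<le> norm B * norm (v :: real^'n) * K"
    using mv.nonneg_bounded by blast
  have "bounded (A ` {t0..T})"
    by (intro compact_imp_bounded compact_continuous_image A) simp
  then obtain B where B: "\<And>u. u \<in> {t0..T} \<Longrightarrow> norm (A u) \<le> B"
    unfolding bounded_iff by (meson imageI)
  \<comment> \<open>By the choice of \<open>B\<close> and \<open>K\<close>, the norm of
    \<open>A u *v w\<close> is at most \<open>M\<close> times that of \<open>w\<close>, for every
    \<open>u\<close> in the interval.\<close>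
  define M where "M = B * K"
  have "v = 0" if v: "X t *v v = 0" for v
  proof -
    define y where "y u = X u *v v" for u
    define \<phi> where "\<phi> u = exp (2 * M * u) * (y u \<bullet> y u)" for u
    have y': "(y has_vector_derivative A u *v y u) (at u within {t0..T})" if "u \<in> {t0..T}" for u
    proof -
      have "(X has_vector_derivative A u ** X u) (at u within {t0..T})"
        using X that by (simp add: fundamental_matrix_def)
      from bounded_linear.has_vector_derivative[OF mv.bounded_linear_left this, of v]
      show ?thesis
        by (simp add: y_def[abs_def] matrix_vector_mul_assoc)
    qed
    have "continuous_on {t0..T} y"
      using y' by (rule continuous_on_vector_derivative)
    then have "continuous_on {t0..T} \<phi>"
      unfolding \<phi>_def by (intro continuous_intros)
    then have cont: "continuous_on {t0..t} \<phi>"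
      by (rule continuous_on_subset) (use t in auto)
    \<comment> \<open>Only interior points are needed for monotonicity, and there the derivative
      within the interval is the ordinary one.\<close>
    have deriv: "\<exists>D. (\<phi> has_real_derivative D) (at u) \<and> 0 \<le> D" if u: "t0 < u" "u < t" for u
    proof (intro exI conjI)
      have uI: "u \<in> {t0..T}" and at: "at u within {t0..T} = at u"
        using u t by (auto intro!: at_within_Icc_at)
      have "(y has_derivative (\<lambda>h. h *\<^sub>R (A u *v y u))) (at u)"
        using y'[OF uI] unfolding at has_vector_derivative_def .
      then have "((\<lambda>u. y u \<bullet> y u) has_derivative
          (\<lambda>h. y u \<bullet> (h *\<^sub>R (A u *v y u)) + (h *\<^sub>R (A u *v y u)) \<bullet> y u)) (at u)"
        by (intro has_derivative_inner)
      then have "((\<lambda>u. y u \<bullet> y u) has_real_derivative 2 * (y u \<bullet> (A u *v y u))) (at u)"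
        unfolding has_field_derivative_def
        by (rule has_derivative_eq_rhs) (auto simp: fun_eq_iff inner_commute)
      then show "(\<phi> has_real_derivative
          exp (2 * M * u) * (2 * (M * (y u \<bullet> y u) + y u \<bullet> (A u *v y u)))) (at u)"
        unfolding \<phi>_def by (auto intro!: derivative_eq_intros simp: algebra_simps)
      have "\<bar>y u \<bullet> (A u *v y u)\<bar> \<le> norm (y u) * norm (A u *v y u)"
        by (rule Cauchy_Schwarz_ineq2)
      also have "\<dots> \<le> norm (y u) * (norm (A u) * norm (y u) * K)"
        by (intro mult_left_mono K) simp
      also have "\<dots> \<le> norm (y u) * (B * norm (y u) * K)"
        by (intro mult_left_mono mult_right_mono K B uI) simp_all
      also have "\<dots> = M * (y u \<bullet> y u)"
        by (simp add: M_def power2_norm_eq_inner[symmetric] power2_eq_square)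
      finally show "0 \<le> exp (2 * M * u) * (2 * (M * (y u \<bullet> y u) + y u \<bullet> (A u *v y u)))"
        by simp
    qed
    have "\<phi> t0 \<le> \<phi> t"
      by (rule DERIV_nonneg_imp_increasing_open[OF _ deriv cont]) (use t in auto)
    moreover have "\<phi> t = 0"
      using v by (simp add: \<phi>_def y_def)
    moreover have "y t0 = v"
      using X by (simp add: y_def fundamental_matrix_def)
    ultimately have "v \<bullet> v \<le> 0"
      by (simp add: \<phi>_def mult_le_0_iff)
    then show "v = 0"
      using inner_gt_zero_iff[of v] by linarith
  qed
  then show ?thesis
    unfolding invertible_left_inverse matrix_left_invertible_ker by blast
qed

text \<open>Product rule for \<open>X t ** matrix_inv Q\<close> and \<open>transpose (X t)\<close>;
  transposing \<open>A t ** X t\<close> moves \<open>transpose (A t)\<close> to the right.\<close>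

lemma H_matrix_has_vector_derivative:
  assumes X: "fundamental_matrix A t0 T X" and t: "t \<in> {t0..T}"
  shows "(H_matrix X Q has_vector_derivative
    (A t ** H_matrix X Q t + H_matrix X Q t ** transpose (A t))) (at t within {t0..T})"
proof -
  have X': "(X has_vector_derivative A t ** X t) (at t within {t0..T})"
    using X t by (simp add: fundamental_matrix_def)
  note X1 = bounded_linear.has_vector_derivative[OF
      bounded_bilinear.bounded_linear_left[OF bounded_bilinear_matrix_matrix_mult] X', of "matrix_inv Q"]
  note X2 = bounded_linear.has_vector_derivative[OF bounded_linear_transpose X']
  from bounded_bilinear.has_vector_derivative[OF bounded_bilinear_matrix_matrix_mult X1 X2]
  show ?thesis
    by (simp add: H_matrix_def[abs_def] matrix_transpose_mul matrix_mul_assoc add.commute)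
qed

text \<open>Identifies the radicand of \<open>bound_ratio\<close> with the one in
  \<open>ellipsoid_abs_inner_le_iff\<close> for \<open>a = v v* X t\<close>.\<close>

lemma inner_H_matrix:
  "v \<bullet> (H_matrix X Q t *v v) = (v v* X t) \<bullet> (matrix_inv Q *v (v v* X t))"
  by (simp add: H_matrix_def dot_lmul_matrix flip: matrix_vector_mul_assoc)

lemma inner_H_matrix_pos:
  assumes Q: "sym_pos_def Q" and X: "invertible (X t)" and "v \<noteq> 0"
  shows "0 < v \<bullet> (H_matrix X Q t *v v)"
proof -
  have "v v* X t \<noteq> 0"
  proof
    assume "v v* X t = 0"
    then have "v v* (X t ** matrix_inv (X t)) = 0"
      by (simp flip: vector_matrix_mul_assoc)
    with \<open>v \<noteq> 0\<close> show False
      by (simp add: matrix_mul_inv_right[OF X])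
  qed
  then show ?thesis
    unfolding inner_H_matrix by (rule sym_pos_def_inv_pos[OF Q])
qed

section \<open>Extended-real quotients and attained minima\<close>

lemma ereal_le_divide_iff:
  assumes "0 \<le> r" and "r = 0 \<Longrightarrow> 0 < p"
  shows "ereal c \<le> ereal p / ereal r \<longleftrightarrow> c * r \<le> p"
  \<comment> \<open>For \<open>r = 0\<close> the quotient is \<open>\<infinity>\<close> because
    \<open>p\<close> is positive, and both sides hold.\<close>
  using assms by (cases "r = 0") (auto simp: divide_ereal_def field_simps)

text \<open>Inversion is continuous at 0 when approached through nonnegative values, and
  \<open>ne\<close> excludes the product of 0 and \<open>\<infinity>\<close>, where multiplication
  is discontinuous.\<close>

lemma continuous_on_ereal_divide:
  fixes f g :: "'a::topological_space \<Rightarrow> real"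
  assumes f: "continuous_on S f" and g: "continuous_on S g"
    and nonneg: "\<And>x. x \<in> S \<Longrightarrow> 0 \<le> g x"
    and ne: "\<And>x. x \<in> S \<Longrightarrow> g x = 0 \<Longrightarrow> f x \<noteq> 0"
  shows "continuous_on S (\<lambda>x. ereal (f x) / ereal (g x))"
  unfolding continuous_on_def
proof
  fix x assume x: "x \<in> S"
  have "((\<lambda>x. ereal (f x)) \<longlongrightarrow> ereal (f x)) (at x within S)"
    "((\<lambda>x. ereal (g x)) \<longlongrightarrow> ereal (g x)) (at x within S)"
    using f g x by (auto simp: continuous_on_def)
  moreover have "\<forall>\<^sub>F x in at x within S. 0 \<le> ereal (g x)"
    using nonneg by (auto simp: eventually_at_filter)
  ultimately show "((\<lambda>x. ereal (f x) / ereal (g x)) \<longlongrightarrow> ereal (f x) / ereal (g x)) (at x within S)"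
    unfolding divide_ereal_def using ne[OF x]
    by (intro tendsto_mult_ereal Extended_Real.tendsto_inverse_ereal) auto
qed

text \<open>The two minimisations are exchanged: each \<open>f _ s\<close> is minimised over
  \<open>K\<close>, then the least of these finitely many values is taken. Continuity of the
  pointwise \<open>Min\<close> is thus avoided.\<close>

lemma is_minimum_Min_attained:
  fixes f :: "'a::topological_space \<Rightarrow> 'b \<Rightarrow> 'c::linorder_topology"
  assumes K: "compact K" "K \<noteq> {}" and S: "finite S" "S \<noteq> {}"
    and f: "\<And>s. s \<in> S \<Longrightarrow> continuous_on K (\<lambda>t. f t s)"
  obtains t s where "t \<in> K" "s \<in> S" "is_minimum (f t s) ((\<lambda>t. Min (f t ` S)) ` K)"
proof -
  have "\<forall>s\<in>S. \<exists>t\<in>K. \<forall>u\<in>K. f t s \<le> f u s"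
    using continuous_attains_inf[OF K f] by blast
  then obtain \<tau> where \<tau>: "\<And>s. s \<in> S \<Longrightarrow> \<tau> s \<in> K"
    "\<And>s u. s \<in> S \<Longrightarrow> u \<in> K \<Longrightarrow> f (\<tau> s) s \<le> f u s"
    by metis
  have "Min ((\<lambda>s. f (\<tau> s) s) ` S) \<in> (\<lambda>s. f (\<tau> s) s) ` S"
    using S by (intro Min_in) auto
  then obtain s where s: "s \<in> S" "f (\<tau> s) s = Min ((\<lambda>s. f (\<tau> s) s) ` S)"
    by auto
  have le: "f (\<tau> s) s \<le> f u r" if "u \<in> K" "r \<in> S" for u r
  proof -
    have "f (\<tau> s) s \<le> f (\<tau> r) r"
      unfolding s(2) using S that by (intro Min_le) auto
    also have "\<dots> \<le> f u r"
      using \<tau>(2) that by blast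
    finally show ?thesis .
  qed
  have "Min (f (\<tau> s) ` S) = f (\<tau> s) s"
    using S s(1) \<tau>(1) le by (intro Min_eqI) auto
  then have "is_minimum (f (\<tau> s) s) ((\<lambda>t. Min (f t ` S)) ` K)"
    unfolding is_minimum_def using \<tau>(1) s(1) S le
    by (auto simp: image_iff intro!: bexI[of _ "\<tau> s"])
  with \<tau>(1) s(1) that show thesis
    by blast
qed

section \<open>Stability as an upper bound on the radius\<close>

theorem mainTheorem4:
  fixes A X :: "real \<Rightarrow> real^'n^'n" and Q :: "real^'n^'n" and z0 :: "real^'n"
    and l :: "nat \<Rightarrow> real \<Rightarrow> real^'n" and N :: nat and t0 T :: real
  assumes "t0 \<le> T" and "1 \<le> N"
    and "continuous_on {t0..T} A"
    and "fundamental_matrix A t0 T X"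
    and "\<And>s. s \<in> {1..N} \<Longrightarrow> continuous_on {t0..T} (l s)"
    and "\<And>t. t \<in> {t0..T} \<Longrightarrow> compact (phase_set N l t)"
    and "sym_pos_def Q"
  shows "(\<exists>cstar::real.
            is_minimum (ereal cstar)
              ((\<lambda>t. Min ((\<lambda>s. bound_ratio X Q l z0 t s) ` {1..N})) ` {t0..T}) \<and>
            ((\<exists>c>0. trivial_solution_stable X (ellipsoid Q z0 c) (phase_set N l) t0 T) \<longrightarrow>
               is_maximum cstar {c. c > 0 \<and> trivial_solution_stable X (ellipsoid Q z0 c) (phase_set N l) t0 T}) \<and>
            ((\<exists>c>0. admissible_initial_set (ellipsoid Q z0 c) (phase_set N l) t0 \<and>
                    trivial_solution_stable X (ellipsoid Q z0 c) (phase_set N l) t0 T) \<longrightarrow>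
               is_maximum cstar
                 {c. c > 0 \<and> admissible_initial_set (ellipsoid Q z0 c) (phase_set N l) t0 \<and>
                     trivial_solution_stable X (ellipsoid Q z0 c) (phase_set N l) t0 T}))
         \<and> (\<forall>t\<in>{t0..T}. (H_matrix X Q has_vector_derivative
               (A t ** H_matrix X Q t + H_matrix X Q t ** transpose (A t))) (at t within {t0..T}))
         \<and> H_matrix X Q t0 = matrix_inv Q"
proof -
  note inv = fundamental_matrix_invertible[OF assms(3,4)]
  note Q = assms(7)
  define h where "h t s = l s t \<bullet> (H_matrix X Q t *v l s t)" for t s
  define p where "p t s = 1 - \<bar>l s t \<bullet> (X t *v z0)\<bar>" for t s
  let ?f = "bound_ratio X Q l z0"
  let ?stable = "\<lambda>c. trivial_solution_stable X (ellipsoid Q z0 c) (phase_set N l) t0 T"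
  let ?adm = "\<lambda>c. admissible_initial_set (ellipsoid Q z0 c) (phase_set N l) t0"
  have f: "?f t s = ereal (p t s) / ereal (sqrt (h t s))" for t s
    by (simp add: bound_ratio_def p_def h_def)
  have h_nonneg: "0 \<le> h t s" for t s
    unfolding h_def inner_H_matrix by (rule sym_pos_def_inv_nonneg[OF Q])
  have h_pos: "0 < h t s" if "t \<in> {t0..T}" "l s t \<noteq> 0" for t s
    unfolding h_def by (rule inner_H_matrix_pos[OF Q inv]) (use that in auto)
  \<comment> \<open>A zero of \<open>h\<close> forces \<open>l s t = 0\<close>, and then
    \<open>p t s = 1\<close>.\<close>
  have p_pos: "0 < p t s" if "t \<in> {t0..T}" "h t s = 0" for t s
    using h_pos[of t s] that by (cases "l s t = 0") (auto simp: p_def)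
  have H': "\<forall>t\<in>{t0..T}. (H_matrix X Q has_vector_derivative
      (A t ** H_matrix X Q t + H_matrix X Q t ** transpose (A t))) (at t within {t0..T})"
    using H_matrix_has_vector_derivative[OF assms(4)] by blast
  then have H_cont: "continuous_on {t0..T} (H_matrix X Q)"
    by (intro continuous_on_vector_derivative) (rule bspec)
  have mv_cont: "continuous_on {t0..T} (\<lambda>t. B t *v v t)"
    if "continuous_on {t0..T} B" "continuous_on {t0..T} v" for B :: "real \<Rightarrow> real^'n^'n" and v
    using that by (rule bounded_bilinear.continuous_on[OF bounded_bilinear_matrix_vector_mult])
  have f_cont: "continuous_on {t0..T} (\<lambda>t. ?f t s)" if "s \<in> {1..N}" for s
    unfolding f
  proof (rule continuous_on_ereal_divide)
    note [continuous_intros] = assms(5)[OF that] H_cont mv_cont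
      fundamental_matrix_continuous_on[OF assms(4)]
    show "continuous_on {t0..T} (\<lambda>t. p t s)"
      unfolding p_def by (intro continuous_intros)
    show "continuous_on {t0..T} (\<lambda>t. sqrt (h t s))"
      unfolding h_def by (intro continuous_intros)
  qed (use h_nonneg p_pos in force)+

  have stable_at: "(\<forall>x\<in>ellipsoid Q z0 c. \<bar>l s t \<bullet> (X t *v x)\<bar> \<le> 1) \<longleftrightarrow> ereal c \<le> ?f t s"
    if "0 \<le> c" "t \<in> {t0..T}" for c t s
  proof -
    have "(\<forall>x\<in>ellipsoid Q z0 c. \<bar>l s t \<bullet> (X t *v x)\<bar> \<le> 1) \<longleftrightarrow> c * sqrt (h t s) \<le> p t s"
      using ellipsoid_abs_inner_le_iff[OF Q that(1), of z0 "l s t v* X t" 1]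
      unfolding dot_lmul_matrix[of "l s t"] h_def inner_H_matrix p_def
      by (auto simp: dot_lmul_matrix)
    also have "\<dots> \<longleftrightarrow> ereal c \<le> ?f t s"
      unfolding f using h_nonneg p_pos that by (intro ereal_le_divide_iff[symmetric]) auto
    finally show ?thesis .
  qed
  have stable: "?stable c \<longleftrightarrow> (\<forall>t\<in>{t0..T}. \<forall>s\<in>{1..N}. ereal c \<le> ?f t s)" if "0 \<le> c" for c
    using stable_at[OF that] unfolding trivial_solution_stable_def phase_set_def solution_def by blast

  obtain t1 s1 where ts1: "t1 \<in> {t0..T}" "s1 \<in> {1..N}"
    and min: "is_minimum (?f t1 s1) ((\<lambda>t. Min (?f t ` {1..N})) ` {t0..T})"
    by (rule is_minimum_Min_attained[of "{t0..T}" "{1..N}" ?f]) (use assms(1,2) f_cont in auto)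
  \<comment> \<open>All the inequalities collapse to the one at the minimising pair.\<close>
  have le_min: "(\<forall>t\<in>{t0..T}. \<forall>s\<in>{1..N}. y \<le> ?f t s) \<longleftrightarrow> y \<le> ?f t1 s1" for y
  proof
    assume y: "y \<le> ?f t1 s1"
    show "\<forall>t\<in>{t0..T}. \<forall>s\<in>{1..N}. y \<le> ?f t s"
    proof (intro ballI)
      fix t s assume ts: "t \<in> {t0..T}" "s \<in> {1..N}"
      have "?f t1 s1 \<le> Min (?f t ` {1..N})"
        using min ts by (auto simp: is_minimum_def)
      also have "\<dots> \<le> ?f t s"
        using ts by simp
      finally show "y \<le> ?f t s"
        using y by simp
    qed
  qed (use ts1 in blast)

  have t0: "t0 \<in> {t0..T}"
    using assms(1) by simp
  have "\<exists>s\<in>{1..N}. l s t0 \<noteq> 0"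
  proof (rule ccontr)
    assume "\<not> ?thesis"
    then have "phase_set N l t0 = UNIV"
      by (auto simp: phase_set_def)
    then have "bounded (UNIV :: (real^'n) set)"
      using assms(6)[OF t0] compact_imp_bounded by metis
    then show False
      by simp
  qed
  then obtain s0 where s0: "s0 \<in> {1..N}" "0 < h t0 s0"
    using h_pos t0 by blast
  have "?f t1 s1 \<le> ?f t0 s0"
    using le_min[of "?f t1 s1"] t0 s0(1) by blast
  also have "\<dots> < \<infinity>"
    using s0(2) by (simp add: f)
  finally have "?f t1 s1 < \<infinity>" .
  \<comment> \<open>A vanishing denominator comes with a positive numerator, giving
    \<open>\<infinity>\<close>; otherwise the quotient is real.\<close>
  moreover have "- \<infinity> < ?f t1 s1"
    using p_pos[OF ts1(1), of s1] by (cases "h t1 s1 = 0") (auto simp: f divide_ereal_def)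
  ultimately obtain m where m: "?f t1 s1 = ereal m"
    by (cases "?f t1 s1") auto
  \<comment> \<open>The sign condition matters: the ellipsoid depends on \<open>c\<close> only
    through its square.\<close>
  have stable_iff: "?stable c \<longleftrightarrow> c \<le> m" if "0 \<le> c" for c
    using stable[OF that] le_min[of "ereal c"] m by simp

  have "is_maximum m {c. c > 0 \<and> ?stable c}" if "\<exists>c>0. ?stable c"
    using that stable_iff by (fastforce simp: is_maximum_def)
  moreover have "is_maximum m {c. c > 0 \<and> ?adm c \<and> ?stable c}" if ex: "\<exists>c>0. ?adm c \<and> ?stable c"
  proof -
    from ex obtain c where c: "c > 0" "?adm c" "?stable c"
      by blast
    have cm: "c \<le> m"
      using c stable_iff by auto
    then have st: "?stable m"
      using c(1) stable_iff by auto
    \<comment> \<open>Enlarging the radius from \<open>c\<close> to \<open>m\<close> keeps 0 in the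
      ellipsoid.\<close>
    have "c\<^sup>2 \<le> m\<^sup>2"
      using c(1) cm by (intro power_mono) auto
    then have "0 \<in> ellipsoid Q z0 m"
      using c(2) by (auto simp: admissible_initial_set_def ellipsoid_def)
    \<comment> \<open>Since \<open>X t0\<close> is the identity, stability at time \<open>t0\<close>
      is exactly the inclusion of the ellipsoid in the phase set.\<close>
    moreover have "X t0 *v x = x" for x
      using assms(4) by (simp add: fundamental_matrix_def)
    then have "ellipsoid Q z0 m \<subseteq> phase_set N l t0"
      using st t0 unfolding trivial_solution_stable_def solution_def by fastforce
    ultimately have "?adm m"
      by (simp add: admissible_initial_set_def)
    with st cm c(1) stable_iff show ?thesis
      by (auto simp: is_maximum_def)
  qed
  moreover have "is_minimum (ereal m) ((\<lambda>t. Min (?f t ` {1..N})) ` {t0..T})"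
    using min m by simp
  moreover have "H_matrix X Q t0 = matrix_inv Q"
    using assms(4) by (simp add: H_matrix_def fundamental_matrix_def)
  ultimately show ?thesis
    using H' by blast
qed

end
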